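(* Let $p_1,p_2$ be permutations of $\{1,\dots,k\}$ whose rightmost letter is $1$ (the least letter), such that $p_1$ avoids the consecutive pattern $132$ and $p_2$ avoids the consecutive pattern $123$. (Thus the complements $C(p_1),C(p_2)$ have $k$, the greatest letter, as their rightmost letter, $C(p_1)$ avoids the consecutive pattern $312$, and $C(p_2)$ avoids the consecutive pattern $321$.) Then, for $k\ge 2$, $$E^{p_1}_{132}(x)=E^{C(p_1)}_{312}(x)=\frac{\int_{0}^{x}t^{k-1}e^{-t^2/2}\,dt}{(k-1)!\left(1-\int_{0}^{x}e^{-t^2/2}\,dt\right)}$$ and $$E^{p_2}_{123}(x)=E^{C(p_2)}_{321}(x)=\frac{e^{x/2}\int_{0}^{x}e^{-t/2}\,t^{k-1}\sin\left(\frac{\sqrt3}{2}t+\frac{\pi}{6}\right)dt}{(k-1)!\,\cos\left(\frac{\sqrt3}{2}x+\frac{\pi}{6}\right)}.$$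
   Context: A permutation $\pi=\pi_1\cdots\pi_n$ of $\{1,\dots,n\}$ contains the consecutive (dash-free) pattern $q=q_1q_2q_3$ if some three consecutive letters $\pi_i\pi_{i+1}\pi_{i+2}$ are order-isomorphic to $q$; otherwise it avoids $q$. A permutation $\pi$ begins with a pattern $p=p_1\cdots p_k$ if $n\ge k$ and $\pi_1\pi_2\cdots\pi_k$ is order-isomorphic to $p$. The complement $C(\sigma)$ of a permutation $\sigma=\sigma_1\cdots\sigma_m$ of $\{1,\dots,m\}$ is $b_1\cdots b_m$ with $b_i=m+1-\sigma_i$. For a consecutive pattern $q$ and a pattern $p$, $E^p_q(x)=\sum_{n\ge0}N^p_q(n)\frac{x^n}{n!}$ is the exponential generating function, where $N^p_q(n)$ is the number of permutations of $\{1,\dots,n\}$ that avoid $q$ and begin with $p$.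
   Formalization: In the second formula the sine in the integral has phase π/3 instead of the printed π/6, which is false: for every k ≥ 2 it gives the coefficient of x^k/k! as sin(π/6)/cos(π/6) = 1/√3, while exactly one permutation is counted. *)

theory Defs
  imports "HOL-Analysis.Analysis" "HOL-Combinatorics.Multiset_Permutations"
begin

(* A permutation of {1..n} is the list of its letters, i.e. an element of
   permutations_of_set {1..n}; lists are 0-indexed, letters start at 1. *)

definition order_isomorphic :: "nat list \<Rightarrow> nat list \<Rightarrow> bool" where
  "order_isomorphic xs ys \<longleftrightarrow> length xs = length ys \<and>
     (\<forall>i < length xs. \<forall>j < length xs. xs ! i < xs ! j \<longleftrightarrow> ys ! i < ys ! j)"

definition contains_consecutive :: "nat list \<Rightarrow> nat list \<Rightarrow> bool" where
  "contains_consecutive q \<pi> \<longleftrightarrow>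
     (\<exists>i. i + length q \<le> length \<pi> \<and> order_isomorphic (take (length q) (drop i \<pi>)) q)"

definition avoids_consecutive :: "nat list \<Rightarrow> nat list \<Rightarrow> bool" where
  "avoids_consecutive q \<pi> \<longleftrightarrow> \<not> contains_consecutive q \<pi>"

definition begins_with :: "nat list \<Rightarrow> nat list \<Rightarrow> bool" where
  "begins_with p \<pi> \<longleftrightarrow> length p \<le> length \<pi> \<and> order_isomorphic (take (length p) \<pi>) p"

(* Truncated subtraction is harmless: letters of a permutation of {1..m} are at most m. *)
definition complement :: "nat list \<Rightarrow> nat list" where
  "complement \<sigma> = map (\<lambda>a. length \<sigma> + 1 - a) \<sigma>"

definition num_avoiding_beginning :: "nat list \<Rightarrow> nat list \<Rightarrow> nat \<Rightarrow> nat" where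
  "num_avoiding_beginning p q n =
     card {\<pi> \<in> permutations_of_set {1..n}. avoids_consecutive q \<pi> \<and> begins_with p \<pi>}"

definition egf_avoiding_beginning :: "nat list \<Rightarrow> nat list \<Rightarrow> real fps" where
  "egf_avoiding_beginning p q = Abs_fps (\<lambda>n. real (num_avoiding_beginning p q n) / fact n)"

end

theory Submission
  imports Defs
begin

text \<open>Split a permutation at its least letter, \<open>\<pi> = \<sigma> m \<tau>\<close>. Both forbidden patterns have their least
  letter first, so \<open>\<pi>\<close> avoids the pattern iff \<open>\<sigma>\<close> and \<open>m \<tau>\<close> do, and \<open>\<pi>\<close> begins with \<open>p = p' 1\<close>
  iff \<open>\<sigma>\<close> begins with \<open>p\<close> or \<open>\<sigma>\<close> is order-isomorphic to \<open>p'\<close>. Writing \<open>A\<close> for the wanted exponential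
  generating function and \<open>B\<close> for that of the \<open>\<tau>\<close> such that \<open>m \<tau>\<close> avoids the pattern, this gives
  \<open>A' = (A + x\<^sup>k\<^sup>-\<^sup>1 / (k - 1)!) B\<close>. The same splitting gives the Riccati equations
  \<open>B' = B\<^sup>2 - x B\<close> for 132 and \<open>B' = B\<^sup>2 - B + 1\<close> for 123, whose solutions make the linear equation
  for \<open>A\<close> integrable by an integrating factor.\<close>

section \<open>Order isomorphism and the splitting at the least letter\<close>

lemma strict_mono_on_map_nth_iff:
  fixes f :: "nat \<Rightarrow> nat"
  assumes "strict_mono_on (set xs) f" "i < length xs" "j < length xs"
  shows "f (xs ! i) < f (xs ! j) \<longleftrightarrow> xs ! i < xs ! j"
  by (rule strict_mono_on_less[OF assms(1)]) (use assms in auto)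

lemma order_isomorphic_map:
  assumes "strict_mono_on (set xs) f"
  shows "order_isomorphic (map f xs) ys \<longleftrightarrow> order_isomorphic xs ys"
  by (auto simp: order_isomorphic_def strict_mono_on_map_nth_iff[OF assms])

lemma order_isomorphic_map_antimono:
  assumes "\<And>x y. x \<in> set xs \<Longrightarrow> y \<in> set xs \<Longrightarrow> f x < f y \<longleftrightarrow> y < x"
    and "\<And>x y. x \<in> set ys \<Longrightarrow> y \<in> set ys \<Longrightarrow> g x < g y \<longleftrightarrow> y < x"
  shows "order_isomorphic (map f xs) (map g ys) \<longleftrightarrow> order_isomorphic xs ys"
  using assms by (auto simp: order_isomorphic_def)

text \<open>The appended letters are least on both sides, so every comparison that involves them is
  settled in advance.\<close>

lemma order_isomorphic_append_min:
  assumes "\<And>x. x \<in> set xs \<Longrightarrow> a < x" "\<And>y. y \<in> set ys \<Longrightarrow> b < y"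
  shows "order_isomorphic (xs @ [a]) (ys @ [b]) \<longleftrightarrow> order_isomorphic xs ys"
proof -
  have "x \<in> set xs \<Longrightarrow> \<not> x < a" "y \<in> set ys \<Longrightarrow> \<not> y < b" for x y
    using assms by (meson less_asym)+
  then show ?thesis
    using assms by (auto simp: order_isomorphic_def nth_append less_Suc_eq all_conj_distrib)
qed

text \<open>The number of positions holding a letter smaller than the \<open>i\<close>-th one is
  preserved by order isomorphism. For distinct letters this number is the rank of the
  \<open>i\<close>-th letter in the common set, and the rank determines the letter.\<close>

lemma order_isomorphic_same_set_eq:
  assumes "order_isomorphic xs ys" "set xs = set ys" "distinct xs" "distinct ys"
  shows "xs = ys"
proof (rule nth_equalityI)
  show len: "length xs = length ys"
    using assms(1) by (simp add: order_isomorphic_def)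
  define rank where "rank = (\<lambda>z. card {y \<in> set xs. y < z})"
  have rank_nth: "card {y \<in> set zs. y < zs ! i} = card {j. j < length zs \<and> zs ! j < zs ! i}"
    if "distinct zs" for zs :: "nat list" and i
  proof -
    have "bij_betw ((!) zs) {j. j < length zs \<and> zs ! j < zs ! i} {y \<in> set zs. y < zs ! i}"
      using that by (auto simp: bij_betw_def inj_on_def nth_eq_iff_index_eq in_set_conv_nth)
    then show ?thesis by (rule bij_betw_same_card[symmetric])
  qed
  have rank_less: "rank y < rank z" if "y \<in> set xs" "y < z" for y z
  proof -
    have "{x \<in> set xs. x < y} \<subseteq> {x \<in> set xs. x < z}"
      using that by (auto intro: less_trans)
    moreover have "y \<in> {x \<in> set xs. x < z}" "y \<notin> {x \<in> set xs. x < y}"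
      using that by auto
    ultimately show ?thesis
      unfolding rank_def by (intro psubset_card_mono) (simp, blast)
  qed
  fix i assume i: "i < length xs"
  have "\<forall>j < length xs. xs ! j < xs ! i \<longleftrightarrow> ys ! j < ys ! i"
    using assms(1) i unfolding order_isomorphic_def by blast
  then have "{j. j < length xs \<and> xs ! j < xs ! i} = {j. j < length ys \<and> ys ! j < ys ! i}"
    using len by auto
  then have "rank (xs ! i) = rank (ys ! i)"
    using rank_nth[OF assms(3)] rank_nth[OF assms(4)] assms(2) by (simp add: rank_def)
  then show "xs ! i = ys ! i"
    using rank_less[of "xs ! i" "ys ! i"] rank_less[of "ys ! i" "xs ! i"] i len assms(2)
      nth_mem[of i xs] nth_mem[of i ys] by (cases "xs ! i" "ys ! i" rule: linorder_cases) auto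
qed

section \<open>Recursive form of avoidance and the split at the least letter\<close>

lemma contains_consecutive_Cons:
  "contains_consecutive q (x # xs) \<longleftrightarrow> begins_with q (x # xs) \<or> contains_consecutive q xs"
proof
  assume "contains_consecutive q (x # xs)"
  then obtain i where i: "i + length q \<le> length (x # xs)"
    "order_isomorphic (take (length q) (drop i (x # xs))) q"
    unfolding contains_consecutive_def by blast
  then show "begins_with q (x # xs) \<or> contains_consecutive q xs"
    by (cases i) (auto simp: begins_with_def contains_consecutive_def)
next
  assume "begins_with q (x # xs) \<or> contains_consecutive q xs"
  then show "contains_consecutive q (x # xs)"
  proof
    assume "begins_with q (x # xs)"
    then show ?thesis
      unfolding contains_consecutive_def begins_with_def by (intro exI[of _ 0]) auto
  next
    assume "contains_consecutive q xs"
    then obtain i where "i + length q \<le> length xs"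
      "order_isomorphic (take (length q) (drop i xs)) q"
      unfolding contains_consecutive_def by blast
    then show ?thesis
      unfolding contains_consecutive_def by (intro exI[of _ "Suc i"]) auto
  qed
qed

text \<open>The patterns 123 and 132 are treated simultaneously: both say that the first of three
  letters is the least, and \<open>s\<close> is the relation (\<open><\<close> or \<open>>\<close>) between the other two.\<close>

fun avoids_min_first :: "(nat \<Rightarrow> nat \<Rightarrow> bool) \<Rightarrow> nat list \<Rightarrow> bool" where
  "avoids_min_first s (a # b # c # xs) \<longleftrightarrow>
     \<not> (a < b \<and> a < c \<and> s b c) \<and> avoids_min_first s (b # c # xs)"
| "avoids_min_first s _ \<longleftrightarrow> True"

text \<open>If \<open>m\<close> lies below all letters of \<open>xs\<close>, this is exactly the
  condition for a forbidden triple at the front of \<open>m # xs\<close>.\<close>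

fun starts_pair :: "(nat \<Rightarrow> nat \<Rightarrow> bool) \<Rightarrow> nat list \<Rightarrow> bool" where
  "starts_pair s (a # b # xs) \<longleftrightarrow> s a b"
| "starts_pair s _ \<longleftrightarrow> False"

lemma all_less_3: "(\<forall>i < Suc (Suc (Suc 0)). P i) \<longleftrightarrow> P 0 \<and> P (Suc 0) \<and> P (Suc (Suc 0))"
  by (auto simp: less_Suc_eq)

lemma begins_with_123: "begins_with [1,2,3] (a # b # c # xs) \<longleftrightarrow> a < b \<and> a < c \<and> b < c"
  unfolding begins_with_def order_isomorphic_def by (auto simp: all_less_3)

lemma begins_with_132: "begins_with [1,3,2] (a # b # c # xs) \<longleftrightarrow> a < b \<and> a < c \<and> b > c"
  unfolding begins_with_def order_isomorphic_def by (auto simp: all_less_3)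

lemma contains_consecutive_short: "length xs < length q \<Longrightarrow> \<not> contains_consecutive q xs"
  by (auto simp: contains_consecutive_def)

lemma avoids_consecutive_123: "avoids_consecutive [1,2,3] = avoids_min_first (<)"
proof
  show "avoids_consecutive [1,2,3] xs = avoids_min_first (<) xs" for xs
  proof (induction "(<) :: nat \<Rightarrow> nat \<Rightarrow> bool" xs rule: avoids_min_first.induct)
    case (1 a b c xs)
    then show ?case
      unfolding avoids_consecutive_def contains_consecutive_Cons[of _ a] begins_with_123 by simp
  qed (auto simp: avoids_consecutive_def intro!: contains_consecutive_short)
qed

lemma avoids_consecutive_132: "avoids_consecutive [1,3,2] = avoids_min_first (>)"
proof
  show "avoids_consecutive [1,3,2] xs = avoids_min_first (>) xs" for xs
  proof (induction "(>) :: nat \<Rightarrow> nat \<Rightarrow> bool" xs rule: avoids_min_first.induct)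
    case (1 a b c xs)
    then show ?case
      unfolding avoids_consecutive_def contains_consecutive_Cons[of _ a] begins_with_132 by simp
  qed (auto simp: avoids_consecutive_def intro!: contains_consecutive_short)
qed

text \<open>A triple with the minimum in second or third place is never of the forbidden kind.\<close>

lemma avoids_min_first_split:
  assumes "\<forall>x\<in>set \<sigma> \<union> set \<tau>. m < x"
  shows "avoids_min_first s (\<sigma> @ m # \<tau>) \<longleftrightarrow>
    avoids_min_first s \<sigma> \<and> avoids_min_first s \<tau> \<and> \<not> starts_pair s \<tau>"
  using assms
proof (induction s \<sigma> rule: avoids_min_first.induct)
  case (1 s a b c xs)
  then show ?case by auto
next
  case ("2_1" s)
  then show ?case by (cases "(s, m # \<tau>)" rule: avoids_min_first.cases) auto
next
  case ("2_2" s v)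
  then have "m < v" by simp
  then have "\<not> v < m" by simp
  then show ?case
    using "2_2" by (cases "(s, v # m # \<tau>)" rule: avoids_min_first.cases;
        cases "(s, m # \<tau>)" rule: avoids_min_first.cases) auto
next
  case ("2_3" s v w)
  then have "m < v" "m < w" by simp_all
  then have "\<not> v < m" "\<not> w < m" by simp_all
  then show ?case
    using "2_3" by (cases "(s, m # \<tau>)" rule: avoids_min_first.cases;
        cases \<tau>) auto
qed

text \<open>The least letter \<open>m\<close> lies behind the prefix being compared, at its end, or
  inside it. In the second case \<open>m\<close> matches \<open>b\<close> and the rest must match
  \<open>p\<close>; the third case is impossible because \<open>b\<close> is the least letter of the
  pattern and stands last.\<close>

lemma begins_with_split:
  assumes "\<forall>x\<in>set \<sigma> \<union> set \<tau>. m < x" "\<forall>x\<in>set p. b < x"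
  shows "begins_with (p @ [b]) (\<sigma> @ m # \<tau>) \<longleftrightarrow> begins_with (p @ [b]) \<sigma> \<or> order_isomorphic \<sigma> p"
proof -
  consider "length p < length \<sigma>" | "length p = length \<sigma>" | "length \<sigma> < length p"
    by linarith
  then show ?thesis
  proof cases
    case 1
    then have "begins_with (p @ [b]) (\<sigma> @ m # \<tau>) \<longleftrightarrow> begins_with (p @ [b]) \<sigma>"
      by (simp add: begins_with_def)
    with 1 show ?thesis by (simp add: order_isomorphic_def)
  next
    case 2
    have "order_isomorphic (\<sigma> @ [m]) (p @ [b]) \<longleftrightarrow> order_isomorphic \<sigma> p"
      by (rule order_isomorphic_append_min) (use assms in auto)
    with 2 show ?thesis by (simp add: begins_with_def)
  next
    case 3
    have "\<not> begins_with (p @ [b]) (\<sigma> @ m # \<tau>)"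
    proof
      assume "begins_with (p @ [b]) (\<sigma> @ m # \<tau>)"
      then have len: "length p \<le> length \<sigma> + length \<tau>"
        and iso: "order_isomorphic (take (Suc (length p)) (\<sigma> @ m # \<tau>)) (p @ [b])"
        by (auto simp: begins_with_def)
      \<comment> \<open>Position \<open>length p\<close> carries \<open>b\<close> in the pattern,
        and position \<open>length \<sigma>\<close> carries \<open>m\<close> in the word. The
        pattern asks for a letter smaller than \<open>m\<close>.\<close>
      have "(\<sigma> @ m # \<tau>) ! length p < (\<sigma> @ m # \<tau>) ! length \<sigma>
        \<longleftrightarrow> (p @ [b]) ! length p < (p @ [b]) ! length \<sigma>"
        using iso 3 len nth_take[of "length p" "Suc (length p)" "\<sigma> @ m # \<tau>"]
          nth_take[of "length \<sigma>" "Suc (length p)" "\<sigma> @ m # \<tau>"]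
        unfolding order_isomorphic_def by (simp del: take_append nth_append_length)
      moreover have "(p @ [b]) ! length p < (p @ [b]) ! length \<sigma>"
        using 3 assms(2) by (simp add: nth_append)
      moreover have "m < (\<sigma> @ m # \<tau>) ! length p"
        using 3 assms(1) len by (auto simp: nth_append nth_Cons')
      ultimately show False by simp
    qed
    with 3 show ?thesis by (auto simp: begins_with_def order_isomorphic_def)
  qed
qed

section \<open>Exponential generating functions\<close>

text \<open>The two pieces around the least letter use arbitrary sets of letters; invariance makes
  their counts depend on the sizes of these sets alone.\<close>

definition order_invariant :: "(nat list \<Rightarrow> bool) \<Rightarrow> bool" where
  "order_invariant P \<longleftrightarrow> (\<forall>f xs. strict_mono_on (set xs) f \<longrightarrow> P (map f xs) = P xs)"

lemma order_invariant_conj [intro]: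
  "order_invariant P \<Longrightarrow> order_invariant Q \<Longrightarrow> order_invariant (\<lambda>xs. P xs \<and> Q xs)"
  by (simp add: order_invariant_def)

lemma order_invariant_disj [intro]:
  "order_invariant P \<Longrightarrow> order_invariant Q \<Longrightarrow> order_invariant (\<lambda>xs. P xs \<or> Q xs)"
  by (simp add: order_invariant_def)

lemma order_invariant_not [intro]:
  "order_invariant P \<Longrightarrow> order_invariant (\<lambda>xs. \<not> P xs)"
  by (simp add: order_invariant_def)

lemma order_invariant_length [intro]: "order_invariant (\<lambda>xs. P (length xs))"
  by (simp add: order_invariant_def)

lemma order_invariant_order_isomorphic [intro]: "order_invariant (\<lambda>xs. order_isomorphic xs p)"
  by (simp add: order_invariant_def order_isomorphic_map)

lemma order_invariant_begins_with [intro]: "order_invariant (begins_with p)"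
  unfolding order_invariant_def begins_with_def
  by (auto simp: take_map order_isomorphic_map[OF monotone_on_subset[OF _ set_take_subset]])

text \<open>Strictly monotone maps preserve and reflect both \<open><\<close> and \<open>>\<close>;
  an arbitrary relation \<open>s\<close> would not do.\<close>

lemma order_invariant_avoids_min_first [intro]:
  assumes "s = (<) \<or> s = (>)"
  shows "order_invariant (avoids_min_first s)"
  unfolding order_invariant_def
proof (intro allI impI)
  fix f :: "nat \<Rightarrow> nat" and xs
  assume "strict_mono_on (set xs) f"
  then show "avoids_min_first s (map f xs) = avoids_min_first s xs"
    using assms
  proof (induction s xs rule: avoids_min_first.induct)
    case (1 s a b c xs)
    have "f x < f y \<longleftrightarrow> x < y" if "x \<in> {a,b,c}" "y \<in> {a,b,c}" for x y
      using 1(2) that by (intro strict_mono_on_less) auto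
    moreover have "strict_mono_on (set (b # c # xs)) f"
      using 1(2) by (rule monotone_on_subset) auto
    ultimately show ?case using 1 by auto
  qed auto
qed

lemma order_invariant_starts_pair [intro]:
  assumes "s = (<) \<or> s = (>)"
  shows "order_invariant (starts_pair s)"
  unfolding order_invariant_def
proof (intro allI impI)
  fix f :: "nat \<Rightarrow> nat" and xs
  assume mono: "strict_mono_on (set xs) f"
  show "starts_pair s (map f xs) = starts_pair s xs"
  proof (cases "(s, xs)" rule: starts_pair.cases)
    case (1 s' a b ys)
    have "f x < f y \<longleftrightarrow> x < y" if "x \<in> {a,b}" "y \<in> {a,b}" for x y
      using mono that 1 by (intro strict_mono_on_less) auto
    then show ?thesis using assms 1 by auto
  qed auto
qed

section \<open>Counting permutations by the letters before and after 1\<close>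

definition num_perms :: "(nat list \<Rightarrow> bool) \<Rightarrow> nat \<Rightarrow> nat" where
  "num_perms P n = card {\<pi> \<in> permutations_of_set {1..n}. P \<pi>}"

definition egf :: "(nat list \<Rightarrow> bool) \<Rightarrow> real fps" where
  "egf P = Abs_fps (\<lambda>n. real (num_perms P n) / fact n)"

text \<open>The increasing enumeration of \<open>B\<close> is composed with the inverse of the
  increasing enumeration of \<open>A\<close>.\<close>

lemma ex_strict_mono_image:
  fixes A B :: "nat set"
  assumes "finite A" "finite B" "card A = card B"
  obtains f where "strict_mono_on A f" "f ` A = B"
proof -
  obtain g where g: "bij_betw g {..<card A} A" "strict_mono_on {..<card A} g"
    using ex_bij_betw_strict_mono_card[OF assms(1)] by blast
  obtain h where h: "bij_betw h {..<card B} B" "strict_mono_on {..<card B} h"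
    using ex_bij_betw_strict_mono_card[OF assms(2)] by blast
  let ?g' = "the_inv_into {..<card A} g"
  have g': "?g' a \<in> {..<card A}" "g (?g' a) = a" if "a \<in> A" for a
    using g(1) that bij_betwE[OF bij_betw_the_inv_into[OF g(1)]] f_the_inv_into_f_bij_betw by auto
  have img: "?g' ` A = {..<card A}"
    using bij_betw_the_inv_into[OF g(1)] by (simp add: bij_betw_def)
  have "strict_mono_on A (h \<circ> ?g')"
  proof (rule strict_mono_onI)
    fix x y assume "x \<in> A" "y \<in> A" "x < y"
    then have "?g' x < ?g' y"
      using g'[of x] g'[of y] strict_mono_on_less[OF g(2)] by metis
    then show "(h \<circ> ?g') x < (h \<circ> ?g') y"
      using strict_mono_onD[OF h(2), of "?g' x" "?g' y"] g'(1) \<open>x \<in> A\<close> \<open>y \<in> A\<close> assms(3) by auto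
  qed
  moreover have "(h \<circ> ?g') ` A = B"
    using h(1) assms(3) unfolding image_comp[symmetric] img by (simp add: bij_betw_def)
  ultimately show ?thesis using that by blast
qed

lemma card_perms_order_invariant:
  assumes "order_invariant P" "finite A"
  shows "card {\<pi> \<in> permutations_of_set A. P \<pi>} = num_perms P (card A)"
proof -
  obtain f where f: "strict_mono_on {1..card A} f" "f ` {1..card A} = A"
    using ex_strict_mono_image[of "{1..card A}" A] assms(2) by auto
  have inj: "inj_on f {1..card A}"
    using f(1) by (rule strict_mono_on_imp_inj_on)
  have P: "P (map f xs) = P xs" if "xs \<in> permutations_of_set {1..card A}" for xs
    using assms(1) that f(1) by (auto simp: order_invariant_def permutations_of_set_def)
  have "{\<pi> \<in> permutations_of_set A. P \<pi>} =
      map f ` {\<pi> \<in> permutations_of_set {1..card A}. P \<pi>}"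
    using permutations_of_set_image_inj[OF inj] P unfolding f(2) by auto
  moreover have "inj_on (map f) {\<pi> \<in> permutations_of_set {1..card A}. P \<pi>}"
    by (rule inj_on_subset[OF inj_on_mapI[of f "permutations_of_set {1..card A}"]])
      (use inj in auto)
  ultimately show ?thesis by (simp add: num_perms_def card_image)
qed

lemma sum_Pow_card:
  fixes g :: "nat \<Rightarrow> nat"
  assumes "finite A"
  shows "(\<Sum>S\<in>Pow A. g (card S)) = (\<Sum>i\<le>card A. (card A choose i) * g i)"
proof -
  have "(\<Sum>S\<in>Pow A. g (card S)) = (\<Sum>i\<le>card A. \<Sum>S\<in>{S \<in> Pow A. card S = i}. g (card S))"
    by (rule sum.group[symmetric]) (use assms in \<open>auto simp: card_mono\<close>)
  also have "\<dots> = (\<Sum>i\<le>card A. (card A choose i) * g i)"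
  proof (rule sum.cong)
    fix i
    have "{S \<in> Pow A. card S = i} = {S. S \<subseteq> A \<and> card S = i}" by auto
    then show "(\<Sum>S\<in>{S \<in> Pow A. card S = i}. g (card S)) = (card A choose i) * g i"
      using n_subsets[OF assms, of i] by simp
  qed simp
  finally show ?thesis .
qed

text \<open>A permutation is determined by the set \<open>S\<close> of letters before 1 and by the
  arrangements of \<open>S\<close> and of its complement in \<open>A\<close>. By invariance only the
  size of \<open>S\<close> matters, which gives the binomial coefficients.\<close>

lemma num_perms_split:
  assumes Q: "order_invariant Q" and R: "order_invariant R"
    and P: "\<And>m \<sigma> \<tau>. \<forall>x\<in>set \<sigma> \<union> set \<tau>. m < x \<Longrightarrow> P (\<sigma> @ m # \<tau>) \<longleftrightarrow> Q \<sigma> \<and> R \<tau>"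
  shows "num_perms P (Suc n) = (\<Sum>i\<le>n. (n choose i) * (num_perms Q i * num_perms R (n - i)))"
proof -
  define A where "A = {2..Suc n}"
  have A: "finite A" "card A = n" "{1..Suc n} = insert 1 A" "\<And>x. x \<in> A \<Longrightarrow> 1 < x"
    by (auto simp: A_def)
  define D where "D = (SIGMA S:Pow A. {\<sigma> \<in> permutations_of_set S. Q \<sigma>} \<times>
    {\<tau> \<in> permutations_of_set (A - S). R \<tau>})"
  define h where "h = (\<lambda>(S :: nat set, \<sigma> :: nat list, \<tau>). \<sigma> @ 1 # \<tau>)"
  have "bij_betw h D {\<pi> \<in> permutations_of_set {1..Suc n}. P \<pi>}"
    unfolding bij_betw_def
  proof (intro conjI subset_antisym subsetI)
    show "inj_on h D"
    proof (rule inj_onI)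
      fix u v assume uv: "u \<in> D" "v \<in> D" "h u = h v"
      obtain S \<sigma> \<tau> S' \<sigma>' \<tau>' where u: "u = (S, \<sigma>, \<tau>)" and v: "v = (S', \<sigma>', \<tau>')"
        by (metis prod_cases3)
      note d = uv(1,2)[unfolded u v] and eq = uv(3)[unfolded u v]
      have sets: "set \<sigma> = S" "set \<tau> = A - S" "set \<sigma>' = S'" "set \<tau>' = A - S'" "S \<subseteq> A" "S' \<subseteq> A"
        using d by (auto simp: D_def permutations_of_set_def)
      have "1 \<notin> A" using A(4) by blast
      then have "1 \<notin> set \<sigma>" "1 \<notin> set \<sigma>'" using sets by auto
      moreover have "1 \<notin> set \<tau>" "1 \<notin> set \<tau>'" using sets \<open>1 \<notin> A\<close> by auto
      \<comment> \<open>Since 1 occurs once, the place of the cut is unique.\<close>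
      ultimately have "\<sigma> = \<sigma>' \<and> \<tau> = \<tau>'"
        using eq append_Cons_eq_iff[of 1 \<sigma> \<tau> \<sigma>' \<tau>'] by (simp add: h_def)
      with sets show "u = v" unfolding u v by auto
    qed
  next
    fix \<pi> assume "\<pi> \<in> h ` D"
    then obtain S \<sigma> \<tau> where d: "S \<subseteq> A" "\<sigma> \<in> permutations_of_set S" "Q \<sigma>"
      "\<tau> \<in> permutations_of_set (A - S)" "R \<tau>" "\<pi> = \<sigma> @ 1 # \<tau>"
      by (auto simp: D_def h_def)
    have "P \<pi>" unfolding d(6)
      by (subst P) (use d A(4) in \<open>auto simp: permutations_of_set_def\<close>)
    moreover have "\<pi> \<in> permutations_of_set {1..Suc n}"
      using d A(4) unfolding A(3) permutations_of_set_def by auto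
    ultimately show "\<pi> \<in> {\<pi> \<in> permutations_of_set {1..Suc n}. P \<pi>}" by simp
  next
    fix \<pi> assume "\<pi> \<in> {\<pi> \<in> permutations_of_set {1..Suc n}. P \<pi>}"
    then have \<pi>: "set \<pi> = insert 1 A" "distinct \<pi>" "P \<pi>"
      using A(3) by (auto simp: permutations_of_set_def)
    then obtain \<sigma> \<tau> where st: "\<pi> = \<sigma> @ 1 # \<tau>"
      using split_list[of 1 \<pi>] by auto
    have "1 \<notin> A" using A(4) by blast
    then have sets: "set \<sigma> \<subseteq> A" "set \<tau> = A - set \<sigma>" "distinct \<sigma>" "distinct \<tau>"
      using \<pi> unfolding st by (auto simp: insert_ident)
    have "Q \<sigma> \<and> R \<tau>"
      using \<pi>(3) unfolding st by (subst (asm) P) (use sets A(4) in auto)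
    then have "(set \<sigma>, \<sigma>, \<tau>) \<in> D" using sets by (auto simp: D_def permutations_of_set_def)
    then show "\<pi> \<in> h ` D" by (rule rev_image_eqI) (simp add: h_def st)
  qed
  then have "num_perms P (Suc n) = card D"
    unfolding num_perms_def by (metis bij_betw_same_card)
  also have "\<dots> = (\<Sum>S\<in>Pow A. card {\<sigma> \<in> permutations_of_set S. Q \<sigma>} *
      card {\<tau> \<in> permutations_of_set (A - S). R \<tau>})"
    unfolding D_def by (subst card_SigmaI) (auto simp: card_cartesian_product A)
  also have "\<dots> = (\<Sum>S\<in>Pow A. num_perms Q (card S) * num_perms R (n - card S))"
    by (rule sum.cong) (auto simp: card_perms_order_invariant Q R A(1) finite_subset card_Diff_subset A(2))
  also have "\<dots> = (\<Sum>i\<le>n. (n choose i) * (num_perms Q i * num_perms R (n - i)))"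
    using sum_Pow_card[OF A(1), of "\<lambda>i. num_perms Q i * num_perms R (n - i)"] A(2) by simp
  finally show ?thesis .
qed

text \<open>Differentiation shifts the index \<open>Suc n\<close> to \<open>n\<close>, and a
  binomial convolution of counts is a product of exponential generating functions.\<close>

lemma fps_deriv_egf_split:
  assumes "order_invariant Q" "order_invariant R"
    and "\<And>m \<sigma> \<tau>. \<forall>x\<in>set \<sigma> \<union> set \<tau>. m < x \<Longrightarrow> P (\<sigma> @ m # \<tau>) \<longleftrightarrow> Q \<sigma> \<and> R \<tau>"
  shows "fps_deriv (egf P) = egf Q * egf R"
proof (rule fps_ext)
  fix n
  have "fps_nth (fps_deriv (egf P)) n = real (num_perms P (Suc n)) / fact n"
    by (simp add: egf_def del: of_nat_Suc)
  also have "\<dots> = (\<Sum>i\<le>n. real ((n choose i) * (num_perms Q i * num_perms R (n - i))) / fact n)"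
    unfolding sum_divide_distrib[symmetric] of_nat_sum[symmetric]
    by (subst num_perms_split[of Q R P]) (use assms in simp_all)
  also have "\<dots> = (\<Sum>i\<le>n. fps_nth (egf Q) i * fps_nth (egf R) (n - i))"
    by (rule sum.cong) (auto simp: egf_def binomial_fact)
  also have "\<dots> = fps_nth (egf Q * egf R) n"
    by (simp add: fps_mult_nth atLeast0AtMost)
  finally show "fps_nth (fps_deriv (egf P)) n = fps_nth (egf Q * egf R) n" .
qed

section \<open>Generating functions of simple conditions\<close>

lemma num_perms_0: "num_perms P 0 = (if P [] then 1 else 0)"
proof -
  have "{\<pi> \<in> permutations_of_set {1..0::nat}. P \<pi>} = (if P [] then {[]} else {})"
    by auto
  then show ?thesis by (simp add: num_perms_def)
qed

lemma num_perms_1: "num_perms P (Suc 0) = (if P [1] then 1 else 0)"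
proof -
  have "{\<pi> \<in> permutations_of_set {1..Suc 0}. P \<pi>} = (if P [1] then {[1]} else {})"
    by (auto simp: permutations_of_set_singleton)
  then show ?thesis by (simp add: num_perms_def)
qed

text \<open>Needed for \<open>j = 0\<close> and \<open>j = 1\<close>: dropping the empty or the
  one-letter permutation produces the correction terms of the Riccati equations.\<close>

lemma num_perms_length_neq:
  "num_perms (\<lambda>\<pi>. P \<pi> \<and> length \<pi> \<noteq> j) n = (if n = j then 0 else num_perms P n)"
proof -
  have "{\<pi> \<in> permutations_of_set {1..n}. P \<pi> \<and> length \<pi> \<noteq> j} =
      (if n = j then {} else {\<pi> \<in> permutations_of_set {1..n}. P \<pi>})"
    by (auto dest: length_finite_permutations_of_set)
  then show ?thesis by (simp add: num_perms_def)
qed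

lemma egf_length_neq_0: "egf (\<lambda>\<pi>. P \<pi> \<and> length \<pi> \<noteq> 0) = egf P - fps_const (if P [] then 1 else 0)"
proof (rule fps_ext)
  fix n
  show "fps_nth (egf (\<lambda>\<pi>. P \<pi> \<and> length \<pi> \<noteq> 0)) n =
      fps_nth (egf P - fps_const (if P [] then 1 else 0)) n"
    unfolding egf_def fps_nth_Abs_fps num_perms_length_neq
    by (cases "n = 0") (simp_all add: num_perms_0)
qed

lemma egf_length_neq_1:
  "egf (\<lambda>\<pi>. P \<pi> \<and> length \<pi> \<noteq> 1) = egf P - fps_const (if P [1] then 1 else 0) * fps_X"
proof (rule fps_ext)
  fix n
  show "fps_nth (egf (\<lambda>\<pi>. P \<pi> \<and> length \<pi> \<noteq> 1)) n =
      fps_nth (egf P - fps_const (if P [1] then 1 else 0) * fps_X) n"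
    unfolding egf_def fps_nth_Abs_fps num_perms_length_neq
    by (cases "n = 1") (simp_all add: num_perms_1)
qed

lemma egf_disj:
  assumes "\<And>\<pi>. \<not> (P \<pi> \<and> Q \<pi>)"
  shows "egf (\<lambda>\<pi>. P \<pi> \<or> Q \<pi>) = egf P + egf Q"
proof (rule fps_ext)
  fix n
  have "{\<pi> \<in> permutations_of_set {1..n}. P \<pi> \<or> Q \<pi>} =
      {\<pi> \<in> permutations_of_set {1..n}. P \<pi>} \<union> {\<pi> \<in> permutations_of_set {1..n}. Q \<pi>}" by auto
  moreover have "{\<pi> \<in> permutations_of_set {1..n}. P \<pi>} \<inter> {\<pi> \<in> permutations_of_set {1..n}. Q \<pi>} = {}"
    using assms by auto
  ultimately have "num_perms (\<lambda>\<pi>. P \<pi> \<or> Q \<pi>) n = num_perms P n + num_perms Q n"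
    unfolding num_perms_def by (simp add: card_Un_disjoint)
  then show "fps_nth (egf (\<lambda>\<pi>. P \<pi> \<or> Q \<pi>)) n = fps_nth (egf P + egf Q) n"
    by (simp add: egf_def add_divide_distrib)
qed

lemma egf_order_isomorphic:
  assumes Q: "order_invariant Q" "Q p" and p: "distinct p"
  shows "egf (\<lambda>\<pi>. Q \<pi> \<and> order_isomorphic \<pi> p) =
    fps_const (1 / fact (length p)) * fps_X ^ length p"
proof (rule fps_ext)
  fix n
  have "num_perms (\<lambda>\<pi>. Q \<pi> \<and> order_isomorphic \<pi> p) n = (if n = length p then 1 else 0)"
  proof (cases "n = length p")
    case True
    \<comment> \<open>Counting over the letters of \<open>p\<close> itself makes \<open>p\<close>
      the single solution. In the application these letters are 2 to \<open>k\<close>, not an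
      initial segment.\<close>
    have "num_perms (\<lambda>\<pi>. Q \<pi> \<and> order_isomorphic \<pi> p) (card (set p)) =
        card {\<pi> \<in> permutations_of_set (set p). Q \<pi> \<and> order_isomorphic \<pi> p}"
      by (rule card_perms_order_invariant[symmetric]) (use Q in auto)
    also have "{\<pi> \<in> permutations_of_set (set p). Q \<pi> \<and> order_isomorphic \<pi> p} = {p}"
      using Q(2) p order_isomorphic_same_set_eq
      by (auto simp: permutations_of_set_def order_isomorphic_def[of p p])
    finally show ?thesis using True p by (simp add: distinct_card)
  next
    case False
    then have "{\<pi> \<in> permutations_of_set {1..n}. Q \<pi> \<and> order_isomorphic \<pi> p} = {}"
      by (auto simp: order_isomorphic_def dest: length_finite_permutations_of_set)
    then show ?thesis using False by (simp add: num_perms_def del: Collect_empty_eq)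
  qed
  then show "fps_nth (egf (\<lambda>\<pi>. Q \<pi> \<and> order_isomorphic \<pi> p)) n =
      fps_nth (fps_const (1 / fact (length p)) * fps_X ^ length p) n"
    by (simp add: egf_def)
qed

section \<open>Differential equations from the split at the least letter\<close>

text \<open>Counts the \<open>\<tau>\<close> such that \<open>m \<tau>\<close> avoids the pattern, where \<open>m\<close> is smaller than all letters of \<open>\<tau>\<close>.\<close>

definition tail_gf :: "(nat \<Rightarrow> nat \<Rightarrow> bool) \<Rightarrow> real fps" where
  "tail_gf s = egf (\<lambda>\<pi>. avoids_min_first s \<pi> \<and> \<not> starts_pair s \<pi>)"

lemma tail_gf_nth_0: "fps_nth (tail_gf s) 0 = 1"
  by (simp add: tail_gf_def egf_def num_perms_0)

text \<open>With \<open>\<sigma>\<close> empty, \<open>m # \<tau>\<close> starts with an ascent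
  unless \<open>\<tau>\<close> is empty too. Removing the one-letter permutation on the left thus
  forces \<open>\<sigma>\<close> to be nonempty on the right:
  \<open>(B - x)' = (B - 1) B\<close>.\<close>

lemma tail_gf_less_ode: "fps_deriv (tail_gf (<)) = 1 - tail_gf (<) + (tail_gf (<))\<^sup>2"
proof -
  let ?B = "\<lambda>\<pi>. avoids_min_first (<) \<pi> \<and> \<not> starts_pair (<) \<pi>"
  have "fps_deriv (egf (\<lambda>\<pi>. ?B \<pi> \<and> length \<pi> \<noteq> 1)) = egf (\<lambda>\<pi>. ?B \<pi> \<and> length \<pi> \<noteq> 0) * egf ?B"
  proof (rule fps_deriv_egf_split)
    fix m :: nat and \<sigma> \<tau> assume m: "\<forall>x\<in>set \<sigma> \<union> set \<tau>. m < x"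
    have "starts_pair (<) (\<sigma> @ m # \<tau>) \<longleftrightarrow> (if \<sigma> = [] then \<tau> \<noteq> [] else starts_pair (<) \<sigma>)"
    proof (cases "(((<) :: nat \<Rightarrow> nat \<Rightarrow> bool), \<sigma>)" rule: starts_pair.cases)
      case "2_1"
      then show ?thesis using m by (cases \<tau>) auto
    next
      case "2_2"
      then show ?thesis using m by auto
    qed auto
    then show "(?B (\<sigma> @ m # \<tau>) \<and> length (\<sigma> @ m # \<tau>) \<noteq> 1) =
        ((?B \<sigma> \<and> length \<sigma> \<noteq> 0) \<and> ?B \<tau>)"
      by (auto simp: avoids_min_first_split[OF m])
  qed (intro order_invariant_conj order_invariant_not order_invariant_avoids_min_first
      order_invariant_starts_pair order_invariant_length; simp)+
  then show ?thesis
    unfolding egf_length_neq_0 egf_length_neq_1 tail_gf_def[symmetric]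
    by (simp add: algebra_simps power2_eq_square)
qed

text \<open>The letter \<open>m\<close> creates an initial descent exactly when one letter precedes
  it, so one-letter \<open>\<sigma>\<close> are excluded: \<open>B' = (B - x) B\<close>.\<close>

lemma tail_gf_greater_ode: "fps_deriv (tail_gf (>)) = (tail_gf (>))\<^sup>2 - fps_X * tail_gf (>)"
proof -
  let ?B = "\<lambda>\<pi>. avoids_min_first (>) \<pi> \<and> \<not> starts_pair (>) \<pi>"
  have "fps_deriv (egf ?B) = egf (\<lambda>\<pi>. ?B \<pi> \<and> length \<pi> \<noteq> 1) * egf ?B"
  proof (rule fps_deriv_egf_split)
    fix m :: nat and \<sigma> \<tau> assume m: "\<forall>x\<in>set \<sigma> \<union> set \<tau>. m < x"
    have "starts_pair (>) (\<sigma> @ m # \<tau>) \<longleftrightarrow> length \<sigma> = 1 \<or> starts_pair (>) \<sigma>"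
    proof (cases "(((>) :: nat \<Rightarrow> nat \<Rightarrow> bool), \<sigma>)" rule: starts_pair.cases)
      case "2_1"
      then show ?thesis using m by (cases \<tau>) auto
    next
      case "2_2"
      then show ?thesis using m by auto
    qed auto
    then show "?B (\<sigma> @ m # \<tau>) = ((?B \<sigma> \<and> length \<sigma> \<noteq> 1) \<and> ?B \<tau>)"
      by (auto simp: avoids_min_first_split[OF m])
  qed (intro order_invariant_conj order_invariant_not order_invariant_avoids_min_first
      order_invariant_starts_pair order_invariant_length; simp)+
  then show ?thesis
    unfolding egf_length_neq_1 tail_gf_def[symmetric]
    by (simp add: algebra_simps power2_eq_square)
qed

text \<open>The two alternatives of \<open>begins_with_split\<close> exclude each other by length.
  The first contributes \<open>A\<close>, the second the single monomial of
  \<open>p\<close>.\<close>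

lemma egf_beginning_ode:
  assumes s: "s = (<) \<or> s = (>)"
    and p: "distinct p" "\<forall>x\<in>set p. b < x" "avoids_min_first s (p @ [b])"
  defines "A \<equiv> egf (\<lambda>\<pi>. avoids_min_first s \<pi> \<and> begins_with (p @ [b]) \<pi>)"
  shows "fps_deriv A = (A + fps_const (1 / fact (length p)) * fps_X ^ length p) * tail_gf s"
    and "fps_nth A 0 = 0"
proof -
  have inv: "order_invariant (avoids_min_first s)" "order_invariant (starts_pair s)"
    using s by auto
  let ?R = "\<lambda>\<pi>. avoids_min_first s \<pi> \<and> \<not> starts_pair s \<pi>"
  have "fps_deriv A = egf (\<lambda>\<pi>. avoids_min_first s \<pi> \<and> begins_with (p @ [b]) \<pi> \<or>
      avoids_min_first s \<pi> \<and> order_isomorphic \<pi> p) * egf ?R"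
    unfolding A_def
  proof (rule fps_deriv_egf_split)
    fix m :: nat and \<sigma> \<tau> assume m: "\<forall>x\<in>set \<sigma> \<union> set \<tau>. m < x"
    show "(avoids_min_first s (\<sigma> @ m # \<tau>) \<and> begins_with (p @ [b]) (\<sigma> @ m # \<tau>)) =
      ((avoids_min_first s \<sigma> \<and> begins_with (p @ [b]) \<sigma> \<or>
      avoids_min_first s \<sigma> \<and> order_isomorphic \<sigma> p) \<and> ?R \<tau>)"
      unfolding avoids_min_first_split[OF m] begins_with_split[OF m p(2)] by blast
  qed (use inv in \<open>intro order_invariant_conj order_invariant_disj order_invariant_not
      order_invariant_order_isomorphic order_invariant_begins_with; simp\<close>)+
  also have "egf (\<lambda>\<pi>. avoids_min_first s \<pi> \<and> begins_with (p @ [b]) \<pi> \<or>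
      avoids_min_first s \<pi> \<and> order_isomorphic \<pi> p) =
      A + egf (\<lambda>\<pi>. avoids_min_first s \<pi> \<and> order_isomorphic \<pi> p)"
    unfolding A_def by (rule egf_disj) (auto simp: begins_with_def order_isomorphic_def)
  also have "egf (\<lambda>\<pi>. avoids_min_first s \<pi> \<and> order_isomorphic \<pi> p) =
      fps_const (1 / fact (length p)) * fps_X ^ length p"
  proof (rule egf_order_isomorphic[OF inv(1) _ p(1)])
    show "avoids_min_first s p"
      \<comment> \<open>The word \<open>p @ [b]\<close> is itself split at its least letter, with
        nothing after it.\<close>
      using p(3) avoids_min_first_split[of p "[]" b s] p(2) by simp
  qed
  finally show "fps_deriv A = (A + fps_const (1 / fact (length p)) * fps_X ^ length p) * tail_gf s"
    by (simp add: tail_gf_def)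
  show "fps_nth A 0 = 0"
    by (simp add: A_def egf_def num_perms_0 begins_with_def)
qed

section \<open>Power series and integrals\<close>

definition gauss_fps :: "real fps" where
  "gauss_fps = Abs_fps (\<lambda>n. if even n then (- 1 / 2) ^ (n div 2) / fact (n div 2) else 0)"

lemma has_fps_expansion_gauss: "(\<lambda>x. exp (- (x\<^sup>2 / 2))) has_fps_expansion gauss_fps"
proof (rule has_fps_expansionI[OF always_eventually], rule allI)
  fix x :: real
  have "(\<lambda>n. (- (x\<^sup>2 / 2)) ^ n /\<^sub>R fact n) sums exp (- (x\<^sup>2 / 2))"
    by (rule exp_converges)
  also have "(\<lambda>n. (- (x\<^sup>2 / 2)) ^ n /\<^sub>R fact n) = (\<lambda>n. fps_nth gauss_fps (2 * n) * x ^ (2 * n))"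
  proof
    fix n
    have "(- (x\<^sup>2 / 2)) ^ n = (x\<^sup>2) ^ n * (- 1 / 2) ^ n"
      unfolding power_mult_distrib[symmetric] by simp
    then show "(- (x\<^sup>2 / 2)) ^ n /\<^sub>R fact n = fps_nth gauss_fps (2 * n) * x ^ (2 * n)"
      by (simp add: gauss_fps_def power_mult[symmetric] field_simps)
  qed
  finally show "(\<lambda>n. fps_nth gauss_fps n * x ^ n) sums exp (- (x\<^sup>2 / 2))"
    \<comment> \<open>The exponential series runs over the even exponents only; the odd coefficients
      vanish.\<close>
    by (subst (asm) sums_mono_reindex[where f = "\<lambda>n. fps_nth gauss_fps n * x ^ n"])
      (auto simp: strict_mono_def gauss_fps_def elim: evenE)
qed

text \<open>Coefficient comparison: for \<open>n = 2 * m + 1\<close> the factor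
  \<open>n + 1 = 2 * (m + 1)\<close> cancels against the factorial and one factor
  \<open>- 1 / 2\<close>.\<close>

lemma fps_deriv_gauss_fps: "fps_deriv gauss_fps = - (fps_X * gauss_fps)"
proof (rule fps_ext)
  fix n
  show "fps_nth (fps_deriv gauss_fps) n = fps_nth (- (fps_X * gauss_fps)) n"
  proof (cases "even n")
    case True
    then show ?thesis by (cases n) (auto simp: gauss_fps_def)
  next
    case False
    then obtain m where "n = 2 * m + 1" by (elim oddE)
    moreover have "real (Suc (2 * m + 1)) * ((- 1 / 2) ^ Suc m / fact (Suc m)) = - ((- 1 / 2) ^ m / fact m)"
    proof -
      have "real (Suc (2 * m + 1)) = 2 * real (Suc m)" by simp
      then show ?thesis unfolding fact_Suc of_nat_mult by (simp add: divide_simps del: of_nat_Suc)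
    qed
    ultimately show ?thesis by (simp add: gauss_fps_def del: of_nat_Suc fact_Suc)
  qed
qed

lemma conv_radius_antimono:
  fixes f g :: "nat \<Rightarrow> 'a :: {banach, real_normed_div_algebra}"
  assumes "\<And>n. norm (g n) \<le> norm (f n)"
  shows "conv_radius f \<le> conv_radius g"
proof (rule conv_radius_geI_ex')
  fix r :: real assume r: "0 < r" "ereal r < conv_radius f"
  then have "summable (\<lambda>n. norm (f n * of_real r ^ n))"
    by (intro abs_summable_in_conv_radius) simp
  then show "summable (\<lambda>n. g n * of_real r ^ n)"
    by (rule summable_comparison_test'[where N = 0]) (use assms in \<open>auto simp: norm_mult intro!: mult_right_mono\<close>)
qed

text \<open>Integration shifts the coefficients and divides them by positive integers, so their
  norms do not grow.\<close>

lemma fps_conv_radius_integral: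
  fixes F :: "'a :: {banach, real_normed_field} fps"
  shows "fps_conv_radius F \<le> fps_conv_radius (fps_integral F a)"
proof -
  have "fps_conv_radius F \<le> conv_radius (\<lambda>n. fps_nth (fps_integral F a) (Suc n))"
    unfolding fps_conv_radius_def
  proof (rule conv_radius_antimono)
    fix n
    show "norm (fps_nth (fps_integral F a) (Suc n)) \<le> norm (fps_nth F n)"
      unfolding fps_integral_nth_0_Suc norm_mult norm_inverse norm_of_nat
      by (rule mult_left_le_one_le) (auto simp: divide_simps)
  qed
  also have "\<dots> = fps_conv_radius (fps_integral F a)"
    by (simp only: fps_conv_radius_def conv_radius_shift[of _ 1, simplified])
  finally show ?thesis .
qed

text \<open>Close to 0 the integrated series is an antiderivative of \<open>f\<close> with value 0
  at 0, and the fundamental theorem of calculus applies.\<close>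

lemma has_fps_expansion_LBINT:
  fixes f :: "real \<Rightarrow> real"
  assumes "f has_fps_expansion F" and cont: "continuous_on UNIV f"
  shows "(\<lambda>x. LBINT t=0..x. f t) has_fps_expansion fps_integral0 F"
  unfolding has_fps_expansion_def
proof
  let ?I = "fps_integral0 F"
  have F: "0 < fps_conv_radius F" "eventually (\<lambda>x. eval_fps F x = f x) (nhds 0)"
    using assms by (auto simp: has_fps_expansion_def)
  from F(1) show pos: "0 < fps_conv_radius ?I"
    by (rule less_le_trans) (rule fps_conv_radius_integral)
  have "eventually (\<lambda>x. x \<in> eball 0 (fps_conv_radius ?I)) (nhds (0::real))"
    by (rule eventually_nhds_in_open) (use pos in \<open>auto simp: zero_ereal_def\<close>)
  with F(2) have "eventually (\<lambda>x. eval_fps F x = f x \<and> x \<in> eball 0 (fps_conv_radius ?I)) (nhds 0)"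
    by eventually_elim auto
  then obtain e where e: "e > 0"
    "\<And>x. \<bar>x\<bar> < e \<Longrightarrow> eval_fps F x = f x \<and> ereal \<bar>x\<bar> < fps_conv_radius ?I"
    unfolding eventually_nhds_metric by (auto simp: dist_real_def eball_def)
  have "eval_fps ?I x = (LBINT t=0..x. f t)" if x: "\<bar>x\<bar> < e" for x
  proof -
    have "(LBINT t=ereal 0..ereal x. f t) = eval_fps ?I x - eval_fps ?I 0"
    proof (rule interval_integral_FTC_finite)
      fix t assume t: "min 0 x \<le> t" "t \<le> max 0 x"
      with x have "\<bar>t\<bar> < e" by auto
      then show "(eval_fps ?I has_vector_derivative f t) (at t within {min 0 x..max 0 x})"
        using has_field_derivative_eval_fps[of t ?I] e(2)[of t]
        by (simp add: fps_deriv_fps_integral has_real_derivative_iff_has_vector_derivative)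
    qed (use cont continuous_on_subset in blast)
    then show ?thesis by (simp add: eval_fps_at_0 zero_ereal_def)
  qed
  with e(1) show "\<forall>\<^sub>F x in nhds 0. eval_fps ?I x = (LBINT t=0..x. f t)"
    unfolding eventually_nhds_metric by (intro exI[of _ e]) (auto simp: dist_real_def)
qed

section \<open>Linear and Riccati equations for formal power series\<close>

text \<open>Each coefficient of \<open>D\<close> is a combination of earlier ones. Applied to the
  difference of two series, this verifies the guessed solutions of the Riccati equations.\<close>

lemma fps_linear_ode_zero:
  fixes D E :: "'a :: {idom, ring_char_0} fps"
  assumes "fps_deriv D = D * E" "fps_nth D 0 = 0"
  shows "D = 0"
proof (rule ccontr)
  assume "D \<noteq> 0"
  have "fps_nth D n = 0" for n
  proof (induction n rule: less_induct)
    case (less n)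
    show ?case
    proof (cases n)
      case (Suc m)
      have "of_nat (Suc m) * fps_nth D (Suc m) = fps_nth (D * E) m"
        using assms(1) by (metis fps_deriv_nth Suc_eq_plus1)
      also have "\<dots> = 0"
        unfolding fps_mult_nth by (rule sum.neutral) (use less Suc in auto)
      finally show ?thesis using Suc by (simp del: of_nat_Suc)
    qed (use assms in simp)
  qed
  then show False using \<open>D \<noteq> 0\<close> by (auto simp: fps_eq_iff)
qed

lemma fps_deriv_eq_integral0:
  fixes F :: "real fps"
  assumes "fps_deriv F = G" "fps_nth F 0 = 0"
  shows "F = fps_integral0 G"
  using fps_integral0_deriv[of F] assms by simp

text \<open>The solution is \<open>B = G / U\<close> with \<open>G = exp (- x\<^sup>2 / 2)\<close> and \<open>U = 1 - \<integral> G\<close>, and \<open>U\<close> is an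
  integrating factor for \<open>A\<close>.\<close>

lemma riccati_gauss:
  fixes A B :: "real fps"
  assumes B: "fps_deriv B = B\<^sup>2 - fps_X * B" "fps_nth B 0 = 1"
    and A: "fps_deriv A = (A + M) * B" "fps_nth A 0 = 0"
  shows "A = fps_integral0 (gauss_fps * M) / (1 - fps_integral0 gauss_fps)"
proof -
  define U where "U = 1 - fps_integral0 gauss_fps"
  have U: "fps_deriv U = - gauss_fps" "fps_nth U 0 = 1"
    by (simp_all add: U_def fps_deriv_fps_integral)
  \<comment> \<open>With \<open>G\<close> for \<open>gauss_fps\<close>, the Riccati equation gives
    \<open>(U B - G)' = (U B - G) (B - x)\<close>, and both terms have constant coefficient
    1.\<close>
  have "U * B - gauss_fps = 0"
    by (rule fps_linear_ode_zero[where E = "B - fps_X"])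
      (simp_all add: U B fps_deriv_gauss_fps gauss_fps_def[THEN arg_cong[of _ _ "\<lambda>f. fps_nth f 0"]]
        algebra_simps power2_eq_square)
  then have UB: "U * B = gauss_fps" by simp
  have "fps_deriv (U * A) = (U * B) * (A + M) - gauss_fps * A"
    by (simp add: U A algebra_simps)
  also have "\<dots> = gauss_fps * M"
    unfolding UB by (simp add: algebra_simps)
  finally have "U * A = fps_integral0 (gauss_fps * M)"
    by (rule fps_deriv_eq_integral0) (simp add: A)
  moreover have "U \<noteq> 0" using U(2) by auto
  ultimately show ?thesis
    unfolding U_def[symmetric] by (metis nonzero_mult_div_cancel_left)
qed

text \<open>The solution is \<open>B = S / C\<close>, for \<open>C = cos (\<surd>3/2 x + \<pi>/6)\<close> and \<open>S = sin (\<surd>3/2 x + \<pi>/3)\<close>, and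
  \<open>exp (- x / 2) C\<close> is an integrating factor for \<open>A\<close>.\<close>

lemma riccati_trig:
  fixes A B C S :: "real fps"
  assumes B: "fps_deriv B = 1 - B + B\<^sup>2" "fps_nth B 0 = 1"
    and A: "fps_deriv A = (A + M) * B" "fps_nth A 0 = 0"
    and C: "fps_deriv C = fps_const (1/2) * C - S" and S: "fps_deriv S = C - fps_const (1/2) * S"
    and CS: "fps_nth C 0 = fps_nth S 0" "fps_nth C 0 \<noteq> 0"
  shows "A = fps_exp (1/2) * fps_integral0 (fps_exp (- 1/2) * S * M) / C"
proof -
  \<comment> \<open>Here \<open>(C B - S)' = (C B - S) (B - 1/2)\<close>, and
    \<open>B(0) = 1\<close> together with \<open>C(0) = S(0)\<close> gives the initial value
    0.\<close>
  have "C * B - S = 0"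
    by (rule fps_linear_ode_zero[where E = "B - fps_const (1/2)"])
      (simp_all add: B C S CS algebra_simps power2_eq_square)
  then have CB: "C * B = S" by simp
  \<comment> \<open>The exponential factor cancels the term \<open>C / 2\<close> of
    \<open>C'\<close>; the remaining \<open>- S A\<close> cancels against
    \<open>C B A = S A\<close>.\<close>
  have "fps_deriv (fps_exp (- 1/2) * C * A) =
      fps_exp (- 1/2) * ((C * B) * (A + M) - S * A + (fps_const (- 1/2) + fps_const (1/2)) * C * A)"
    by (simp only: fps_deriv_mult fps_exp_deriv C A) (simp only: algebra_simps)
  also have "fps_const (- 1/2) + fps_const (1/2 :: real) = 0"
    by (simp add: fps_const_add[symmetric] del: fps_const_add) 
  also have "fps_exp (- 1/2) * ((C * B) * (A + M) - S * A + 0 * C * A) = fps_exp (- 1/2) * S * M"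
    unfolding CB by (simp add: algebra_simps)
  finally have "fps_exp (- 1/2) * C * A = fps_integral0 (fps_exp (- 1/2) * S * M)"
    by (rule fps_deriv_eq_integral0) (simp add: A)
  then have "fps_exp (1/2) * fps_integral0 (fps_exp (- 1/2) * S * M) =
      (fps_exp (1/2) * fps_exp (- 1/2)) * (C * A)"
    by (simp only: mult.assoc)
  also have "fps_exp (1/2) * fps_exp (- 1/2) = (1 :: real fps)"
    by (simp add: fps_exp_add_mult[symmetric])
  finally have "fps_exp (1/2) * fps_integral0 (fps_exp (- 1/2) * S * M) = C * A" by simp
  moreover have "C \<noteq> 0" using CS by auto
  ultimately show ?thesis by (metis nonzero_mult_div_cancel_left)
qed

section \<open>Complements\<close>

text \<open>The bounds keep the subtraction from truncating, so both maps reverse the order and the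
  reversals cancel. Separate \<open>m\<close> and \<open>n\<close> are needed because a window of a
  word is complemented with the length of the whole word.\<close>

lemma order_isomorphic_complement:
  assumes "set xs \<subseteq> {..m}" "set ys \<subseteq> {..n}"
  shows "order_isomorphic (map (\<lambda>a. m + 1 - a) xs) (map (\<lambda>a. n + 1 - a) ys) \<longleftrightarrow>
    order_isomorphic xs ys"
  by (rule order_isomorphic_map_antimono) (use assms in auto)

lemma avoids_consecutive_complement:
  assumes "set xs \<subseteq> {..length xs}" "set q \<subseteq> {..length q}"
  shows "avoids_consecutive (complement q) (complement xs) \<longleftrightarrow> avoids_consecutive q xs"
proof -
  have "order_isomorphic (take (length q) (drop i (complement xs))) (complement q) \<longleftrightarrow>
      order_isomorphic (take (length q) (drop i xs)) q" for i
    unfolding complement_def drop_map take_map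
    by (intro order_isomorphic_complement order.trans[OF set_take_subset]
        order.trans[OF set_drop_subset] assms)
  moreover have "length (complement ys) = length ys" for ys
    by (simp add: complement_def)
  ultimately show ?thesis
    by (simp add: avoids_consecutive_def contains_consecutive_def)
qed

lemma begins_with_complement:
  assumes "set xs \<subseteq> {..length xs}" "set p \<subseteq> {..length p}"
  shows "begins_with (complement p) (complement xs) \<longleftrightarrow> begins_with p xs"
proof -
  have "order_isomorphic (take (length p) (complement xs)) (complement p) \<longleftrightarrow>
      order_isomorphic (take (length p) xs) p"
    unfolding complement_def take_map
    by (intro order_isomorphic_complement order.trans[OF set_take_subset] assms)
  moreover have "length (complement ys) = length ys" for ys
    by (simp add: complement_def)
  ultimately show ?thesis by (simp add: begins_with_def)
qed

lemma complement_permutations_of_set: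
  "bij_betw complement (permutations_of_set {1..n}) (permutations_of_set {1..n})"
proof -
  have inj: "inj_on (\<lambda>a. n + 1 - a) {1..n}" by (auto simp: inj_on_def)
  have img: "(\<lambda>a. n + 1 - a) ` {1..n} = {1..n}"
  proof (intro subset_antisym subsetI)
    fix x assume "x \<in> {1..n}"
    then show "x \<in> (\<lambda>a. n + 1 - a) ` {1..n}" by (intro image_eqI[of _ _ "n + 1 - x"]) auto
  qed auto
  have "bij_betw (map (\<lambda>a. n + 1 - a)) (permutations_of_set {1..n}) (permutations_of_set {1..n})"
    unfolding bij_betw_def
  proof
    show "inj_on (map (\<lambda>a. n + 1 - a)) (permutations_of_set {1..n})"
      by (rule inj_on_mapI) (use inj in auto)
    show "map (\<lambda>a. n + 1 - a) ` permutations_of_set {1..n} = permutations_of_set {1..n}"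
      using permutations_of_set_image_inj[OF inj] unfolding img by simp
  qed
  \<comment> \<open>All permutations of \<open>{1..n}\<close> have length \<open>n\<close>, so there
    \<open>complement\<close> agrees with one fixed letterwise map.\<close>
  then show ?thesis
    by (subst bij_betw_cong[of _ _ "map (\<lambda>a. n + 1 - a)"])
      (auto simp: complement_def dest: length_finite_permutations_of_set)
qed

lemma permutations_of_set_bound:
  "\<pi> \<in> permutations_of_set {1..n} \<Longrightarrow> set \<pi> \<subseteq> {..length \<pi>}"
  using length_finite_permutations_of_set[of \<pi> "{1..n}"] permutations_of_setD(1)[of \<pi> "{1..n}"]
  by simp

lemma egf_avoiding_beginning_complement:
  assumes "set p \<subseteq> {..length p}" "set q \<subseteq> {..length q}"
  shows "egf_avoiding_beginning (complement p) (complement q) = egf_avoiding_beginning p q"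
proof -
  have "num_avoiding_beginning p q n = num_avoiding_beginning (complement p) (complement q) n" for n
  proof -
    have "bij_betw complement
        {\<pi> \<in> permutations_of_set {1..n}. avoids_consecutive q \<pi> \<and> begins_with p \<pi>}
        {\<pi> \<in> permutations_of_set {1..n}.
          avoids_consecutive (complement q) \<pi> \<and> begins_with (complement p) \<pi>}"
      by (rule bij_betw_Collect[OF complement_permutations_of_set])
        (simp add: avoids_consecutive_complement begins_with_complement permutations_of_set_bound assms)
    then show ?thesis
      unfolding num_avoiding_beginning_def by (rule bij_betw_same_card)
  qed
  then show ?thesis by (simp add: egf_avoiding_beginning_def)
qed

section \<open>The generating functions\<close>

text \<open>Puts the pattern into the form \<open>p @ [b]\<close> of
  \<open>egf_beginning_ode\<close>, with \<open>b = 1\<close>.\<close>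

lemma last_one_decomp:
  assumes "p \<in> permutations_of_set {1..k}" "last p = 1" "k \<ge> 1"
  obtains p' where "p = p' @ [1]" "length p' = k - 1" "distinct p'" "\<forall>x\<in>set p'. 1 < x"
proof
  have p: "set p = {1..k}" "distinct p" "length p = k"
    using assms(1) length_finite_permutations_of_set[OF assms(1)] by (auto dest: permutations_of_setD)
  then have ne: "p \<noteq> []" using assms(3) by auto
  then show eq: "p = butlast p @ [1]" using assms(2) by (metis append_butlast_last_id)
  show "length (butlast p) = k - 1" using p by simp
  show "distinct (butlast p)" using p(2) by (rule distinct_butlast)
  have "distinct (butlast p @ [1])" using p(2) eq by simp
  then have "1 \<notin> set (butlast p)" by simp
  moreover have "x \<ge> 1" if "x \<in> set (butlast p)" for x
    using that p(1) in_set_butlastD by fastforce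
  ultimately show "\<forall>x\<in>set (butlast p). 1 < x" by (metis le_neq_implies_less)
qed

lemma egf_avoiding_beginning_eq_egf:
  "egf_avoiding_beginning p q = egf (\<lambda>\<pi>. avoids_consecutive q \<pi> \<and> begins_with p \<pi>)"
  by (simp add: egf_avoiding_beginning_def egf_def num_avoiding_beginning_def num_perms_def)

lemma has_fps_expansion_egf_132:
  assumes p: "p \<in> permutations_of_set {1..k}" "last p = 1" "avoids_consecutive [1,3,2] p" and k: "k \<ge> 1"
  shows "(\<lambda>x::real. (LBINT t=0..x. t ^ (k - 1) * exp (- (t\<^sup>2 / 2))) /
      (fact (k - 1) * (1 - (LBINT t=0..x. exp (- (t\<^sup>2 / 2))))))
    has_fps_expansion egf_avoiding_beginning p [1,3,2]"
proof -
  obtain p' where p': "p = p' @ [1]" "length p' = k - 1" "distinct p'" "\<forall>x\<in>set p'. 1 < x"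
    using last_one_decomp[OF p(1,2) k] .
  define A where "A = egf_avoiding_beginning p [1,3,2]"
  define M :: "real fps" where "M = fps_const (1 / fact (k - 1)) * fps_X ^ (k - 1)"
  have A: "fps_deriv A = (A + M) * tail_gf (>)" "fps_nth A 0 = 0"
    using egf_beginning_ode[of "(>)" p' 1] p p'
    by (simp_all add: A_def M_def egf_avoiding_beginning_eq_egf avoids_consecutive_132 del: One_nat_def)
  have A_eq: "A = fps_integral0 (gauss_fps * M) / (1 - fps_integral0 gauss_fps)"
    by (rule riccati_gauss[OF tail_gf_greater_ode tail_gf_nth_0 A])
  have num: "(\<lambda>x. LBINT t=0..x. exp (- (t\<^sup>2 / 2)) * (1 / fact (k - 1) * t ^ (k - 1)))
      has_fps_expansion fps_integral0 (gauss_fps * M)"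
    unfolding M_def
    by (intro has_fps_expansion_LBINT has_fps_expansion_mult has_fps_expansion_cmult_left
        has_fps_expansion_gauss has_fps_expansion_fps_X_power continuous_intros) auto
  have den: "(\<lambda>x. LBINT t=0..x. exp (- (t\<^sup>2 / 2))) has_fps_expansion fps_integral0 gauss_fps"
    by (intro has_fps_expansion_LBINT has_fps_expansion_gauss continuous_intros) auto
  have "(\<lambda>x::real. (LBINT t=0..x. exp (- (t\<^sup>2 / 2)) * (1 / fact (k - 1) * t ^ (k - 1))) /
      (1 - (LBINT t=0..x. exp (- (t\<^sup>2 / 2))))) has_fps_expansion A"
    unfolding A_eq
    \<comment> \<open>The denominator has constant coefficient 1, so the quotient is a power
      series.\<close>
    by (rule has_fps_expansion_divide'[OF num has_fps_expansion_diff[OF has_fps_expansion_1 den]]) simp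
  moreover have "(LBINT t=0..x. exp (- (t\<^sup>2 / 2)) * (1 / fact (k - 1) * t ^ (k - 1))) =
      (LBINT t=0..x. t ^ (k - 1) * exp (- (t\<^sup>2 / 2))) / fact (k - 1)" for x :: real
    unfolding interval_lebesgue_integral_divide[symmetric] by (simp add: mult.commute)
  ultimately show ?thesis by (simp add: A_def)
qed

text \<open>The sine has phase \<open>pi / 3\<close>, the cosine \<open>pi / 6\<close>: their
  quotient is \<open>tail_gf (<)\<close>, whose constant coefficient is 1, and
  \<open>sin (pi / 3) = cos (pi / 6)\<close>. A sine of phase \<open>pi / 6\<close> would start with
  1/2 instead.\<close>

lemma has_fps_expansion_egf_123:
  assumes p: "p \<in> permutations_of_set {1..k}" "last p = 1" "avoids_consecutive [1,2,3] p" and k: "k \<ge> 1"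
  shows "(\<lambda>x::real. exp (x / 2) *
      (LBINT t=0..x. exp (- (t / 2)) * t ^ (k - 1) * sin (sqrt 3 / 2 * t + pi / 3)) /
      (fact (k - 1) * cos (sqrt 3 / 2 * x + pi / 6)))
    has_fps_expansion egf_avoiding_beginning p [1,2,3]"
proof -
  obtain p' where p': "p = p' @ [1]" "length p' = k - 1" "distinct p'" "\<forall>x\<in>set p'. 1 < x"
    using last_one_decomp[OF p(1,2) k] .
  define A where "A = egf_avoiding_beginning p [1,2,3]"
  define M :: "real fps" where "M = fps_const (1 / fact (k - 1)) * fps_X ^ (k - 1)"
  let ?c = "fps_cos (sqrt 3 / 2)" and ?s = "fps_sin (sqrt 3 / 2)"
  \<comment> \<open>\<open>C\<close> and \<open>S\<close> are the addition formulas for the shifted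
    cosine and sine, written with formal series.\<close>
  define C where "C = fps_const (sqrt 3 / 2) * ?c - fps_const (1 / 2) * ?s"
  define S where "S = fps_const (1 / 2) * ?s + fps_const (sqrt 3 / 2) * ?c"
  have C_exp: "(\<lambda>x. cos (sqrt 3 / 2 * x + pi / 6)) has_fps_expansion C"
  proof -
    have "(\<lambda>x. sqrt 3 / 2 * cos (sqrt 3 / 2 * x) - 1 / 2 * sin (sqrt 3 / 2 * x)) has_fps_expansion C"
      unfolding C_def by (intro fps_expansion_intros)
    then show ?thesis by (simp add: cos_add cos_30 sin_30 mult.commute)
  qed
  have S_exp: "(\<lambda>x. sin (sqrt 3 / 2 * x + pi / 3)) has_fps_expansion S"
  proof -
    have "(\<lambda>x. 1 / 2 * sin (sqrt 3 / 2 * x) + sqrt 3 / 2 * cos (sqrt 3 / 2 * x)) has_fps_expansion S"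
      unfolding S_def by (intro fps_expansion_intros)
    then show ?thesis by (simp add: sin_add cos_60 sin_60 mult.commute)
  qed
  have A: "fps_deriv A = (A + M) * tail_gf (<)" "fps_nth A 0 = 0"
    using egf_beginning_ode[of "(<)" p' 1] p p'
    by (simp_all add: A_def M_def egf_avoiding_beginning_eq_egf avoids_consecutive_123 del: One_nat_def)
  have C: "fps_deriv C = fps_const (1/2) * C - S" and S: "fps_deriv S = C - fps_const (1/2) * S"
    by (rule fps_ext, simp add: C_def S_def fps_cos_deriv fps_sin_deriv algebra_simps
        flip: fps_const_neg)+
  have C0: "fps_nth C 0 = fps_nth S 0" "fps_nth C 0 \<noteq> 0"
    by (simp_all add: C_def S_def)
  have A_eq: "A = fps_exp (1/2) * fps_integral0 (fps_exp (- 1/2) * S * M) / C"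
    by (rule riccati_trig[OF tail_gf_less_ode tail_gf_nth_0 A C S C0])
  have num: "(\<lambda>x. LBINT t=0..x. exp (- 1/2 * t) * sin (sqrt 3 / 2 * t + pi / 3) *
      (1 / fact (k - 1) * t ^ (k - 1))) has_fps_expansion fps_integral0 (fps_exp (- 1/2) * S * M)"
    unfolding M_def
    by (intro has_fps_expansion_LBINT has_fps_expansion_mult has_fps_expansion_cmult_left S_exp
        has_fps_expansion_exp has_fps_expansion_fps_X_power continuous_intros) auto
  have "(\<lambda>x::real. exp (1/2 * x) * (LBINT t=0..x. exp (- 1/2 * t) *
      sin (sqrt 3 / 2 * t + pi / 3) * (1 / fact (k - 1) * t ^ (k - 1))) /
      cos (sqrt 3 / 2 * x + pi / 6)) has_fps_expansion A"
    unfolding A_eq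
    by (rule has_fps_expansion_divide'[OF has_fps_expansion_mult[OF has_fps_expansion_exp num] C_exp C0(2)])
  moreover have "(LBINT t=0..x. exp (- 1/2 * t) * sin (sqrt 3 / 2 * t + pi / 3) *
      (1 / fact (k - 1) * t ^ (k - 1))) =
      (LBINT t=0..x. exp (- (t / 2)) * t ^ (k - 1) * sin (sqrt 3 / 2 * t + pi / 3)) / fact (k - 1)"
    for x :: real
    unfolding interval_lebesgue_integral_divide[symmetric] by (simp add: mult_ac)
  ultimately show ?thesis by (simp add: A_def)
qed

theorem theorem2:
  fixes k :: nat and p1 p2 :: "nat list"
  assumes "k \<ge> 2"
    and "p1 \<in> permutations_of_set {1..k}" and "last p1 = 1" and "avoids_consecutive [1,3,2] p1"
    and "p2 \<in> permutations_of_set {1..k}" and "last p2 = 1" and "avoids_consecutive [1,2,3] p2"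
  shows "last (complement p1) = k \<and> avoids_consecutive [3,1,2] (complement p1) \<and>
         last (complement p2) = k \<and> avoids_consecutive [3,2,1] (complement p2) \<and>
         egf_avoiding_beginning p1 [1,3,2] = egf_avoiding_beginning (complement p1) [3,1,2] \<and>
         (\<lambda>x::real. (LBINT t=0..x. t ^ (k - 1) * exp (- (t\<^sup>2 / 2))) /
              (fact (k - 1) * (1 - (LBINT t=0..x. exp (- (t\<^sup>2 / 2))))))
           has_fps_expansion egf_avoiding_beginning (complement p1) [3,1,2] \<and>
         egf_avoiding_beginning p2 [1,2,3] = egf_avoiding_beginning (complement p2) [3,2,1] \<and>
         (\<lambda>x::real. exp (x / 2) *
              (LBINT t=0..x. exp (- (t / 2)) * t ^ (k - 1) * sin (sqrt 3 / 2 * t + pi / 3)) /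
              (fact (k - 1) * cos (sqrt 3 / 2 * x + pi / 6)))
           has_fps_expansion egf_avoiding_beginning (complement p2) [3,2,1]"
proof -
  have q: "complement [1,3,2] = [3,1,2]" "complement [1,2,3] = [3,2,1]"
    by (simp_all add: complement_def)
  have qs: "set [1,3,2] \<subseteq> {..length [1,3,2::nat]}" "set [1,2,3] \<subseteq> {..length [1,2,3::nat]}"
    by auto
  have last: "last (complement p) = k" if "p \<in> permutations_of_set {1..k}" "last p = 1" for p
  proof -
    have "length p = k" using length_finite_permutations_of_set[OF that(1)] by simp
    moreover from this have "p \<noteq> []" using \<open>k \<ge> 2\<close> by auto
    ultimately show ?thesis using that(2) by (simp add: complement_def last_map)
  qed
  note bound = permutations_of_set_bound[OF assms(2)] permutations_of_set_bound[OF assms(5)]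
  have avoid: "avoids_consecutive [3,1,2] (complement p1)" "avoids_consecutive [3,2,1] (complement p2)"
    using avoids_consecutive_complement[OF bound(1) qs(1)] avoids_consecutive_complement[OF bound(2) qs(2)]
      assms(4,7) unfolding q by simp_all
  \<comment> \<open>Complementation reduces both claims about 312 and 321 to the formulas for 132
    and 123.\<close>
  have egf_eq: "egf_avoiding_beginning (complement p1) [3,1,2] = egf_avoiding_beginning p1 [1,3,2]"
    "egf_avoiding_beginning (complement p2) [3,2,1] = egf_avoiding_beginning p2 [1,2,3]"
    using egf_avoiding_beginning_complement[OF bound(1) qs(1)]
      egf_avoiding_beginning_complement[OF bound(2) qs(2)] unfolding q by simp_all
  show ?thesis
    unfolding egf_eq
    using last[OF assms(2,3)] last[OF assms(5,6)] avoid
      has_fps_expansion_egf_132[OF assms(2-4)] has_fps_expansion_egf_123[OF assms(5-7)] assms(1)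
    by simp
qed

end
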